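(* Let $X$ be a first countable Hausdorff topological space such that all closed subsets of $X$ are separable, let $x=(x_n)_{n\in\mathbf{N}}$ be a sequence with values in $X$, and let $\mathcal{I}$ be a meager ideal on $\mathbf{N}$. Define $$\Sigma_x(\mathcal{I}):=\{\sigma\in\Sigma:\Gamma_{\sigma(x)}(\mathcal{I})=\Gamma_x(\mathcal{I})\}\quad\text{and}\quad \Pi_x(\mathcal{I}):=\{\pi\in\Pi:\Gamma_{\pi(x)}(\mathcal{I})=\Gamma_x(\mathcal{I})\}.$$ Then the following are equivalent: (1) $\Sigma_x(\mathcal{I})$ is comeager in $\Sigma$; (2) $\Sigma_x(\mathcal{I})$ is not meager in $\Sigma$; (3) $\Pi_x(\mathcal{I})$ is comeager in $\Pi$; (4) $\Pi_x(\mathcal{I})$ is not meager in $\Pi$; (5) $\Gamma_x(\mathcal{I})=\mathrm{L}_x$.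
   Context: $\mathbf{N}$ denotes the positive integers. An ideal on $\mathbf{N}$ is a family $\mathcal{I}\subseteq\mathcal{P}(\mathbf{N})$ closed under subsets and finite unions; it is always assumed that $\mathcal{I}$ contains the ideal $\mathrm{Fin}$ of all finite subsets of $\mathbf{N}$ and that $\mathcal{I}\neq\mathcal{P}(\mathbf{N})$. Ideals are regarded as subsets of the Cantor space $\{0,1\}^{\mathbf{N}}$ (identifying sets with characteristic functions); $\mathcal{I}$ is meager if it is a meager subset of this space. For a sequence $x=(x_n)$ in a topological space $X$, a point $\ell\in X$ is an $\mathcal{I}$-cluster point of $x$ if $\{n\in\mathbf{N}:x_n\in U\}\notin\mathcal{I}$ for every neighborhood $U$ of $\ell$. $\Gamma_x(\mathcal{I})$ is the set of $\mathcal{I}$-cluster points of $x$, and $\mathrm{L}_x:=\Gamma_x(\mathrm{Fin})$ is the set of ordinary accumulation points of $x$. $\Sigma$ is the set of strictly increasing functions $\sigma:\mathbf{N}\to\mathbf{N}$ and $\Pi$ is the set of bijections $\pi:\mathbf{N}\to\mathbf{N}$; both carry the subspace topology from $\mathbf{N}^{\mathbf{N}}$ (product of discrete topologies), and are Polish. For $\sigma\in\Sigma$, $\sigma(x)$ denotes the subsequence $(x_{\sigma(n)})_n$; for $\pi\in\Pi$, $\pi(x)$ denotes the rearranged sequence $(x_{\pi(n)})_n$. *)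

theory Defs
  imports "HOL-Analysis.Analysis"
begin

text \<open>
  The index set of sequences and the ground set of ideals is the type \<open>nat\<close>, whose order type
  is that of the positive integers. All notions below depend only on the index set and its order,
  so the shift of the first index from 1 to 0 is immaterial.
\<close>

definition nowhere_dense_in :: "'a topology \<Rightarrow> 'a set \<Rightarrow> bool" where
  "nowhere_dense_in T S \<longleftrightarrow> S \<subseteq> topspace T \<and> T interior_of (T closure_of S) = {}"

definition meager_in :: "'a topology \<Rightarrow> 'a set \<Rightarrow> bool" where
  "meager_in T S \<longleftrightarrow> (\<exists>\<N>. countable \<N> \<and> (\<forall>N\<in>\<N>. nowhere_dense_in T N) \<and> S = \<Union>\<N>)"

definition comeager_in :: "'a topology \<Rightarrow> 'a set \<Rightarrow> bool" where
  "comeager_in T S \<longleftrightarrow> S \<subseteq> topspace T \<and> meager_in T (topspace T - S)"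

text \<open>As is customary, ideals are proper and contain all finite sets.\<close>

definition nat_ideal :: "nat set set \<Rightarrow> bool" where
  "nat_ideal I \<longleftrightarrow>
     (\<forall>A\<in>I. \<forall>B. B \<subseteq> A \<longrightarrow> B \<in> I) \<and>
     (\<forall>A\<in>I. \<forall>B\<in>I. A \<union> B \<in> I) \<and>
     {A. finite A} \<subseteq> I \<and>
     I \<noteq> UNIV"

definition cantor_space :: "(nat \<Rightarrow> bool) topology" where
  "cantor_space = product_topology (\<lambda>_. discrete_topology UNIV) UNIV"

definition baire_space :: "(nat \<Rightarrow> nat) topology" where
  "baire_space = product_topology (\<lambda>_. discrete_topology UNIV) UNIV"

text \<open>A set \<open>A\<close> is identified with its characteristic function \<open>\<lambda>n. n \<in> A\<close>.\<close>

definition meager_ideal :: "nat set set \<Rightarrow> bool" where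
  "meager_ideal I \<longleftrightarrow> nat_ideal I \<and> meager_in cantor_space ((\<lambda>A n. n \<in> A) ` I)"

text \<open>Neighbourhoods are not required to be open.\<close>

definition neighborhood_in :: "'a topology \<Rightarrow> 'a \<Rightarrow> 'a set \<Rightarrow> bool" where
  "neighborhood_in X l U \<longleftrightarrow> U \<subseteq> topspace X \<and> (\<exists>V. openin X V \<and> l \<in> V \<and> V \<subseteq> U)"

definition cluster_points :: "'a topology \<Rightarrow> nat set set \<Rightarrow> (nat \<Rightarrow> 'a) \<Rightarrow> 'a set" where
  "cluster_points X I x =
     {l \<in> topspace X. \<forall>U. neighborhood_in X l U \<longrightarrow> {n. x n \<in> U} \<notin> I}"

definition accumulation_points :: "'a topology \<Rightarrow> (nat \<Rightarrow> 'a) \<Rightarrow> 'a set" where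
  "accumulation_points X x = cluster_points X {A. finite A} x"

definition Sigma_space :: "(nat \<Rightarrow> nat) topology" where
  "Sigma_space = subtopology baire_space {\<sigma>. strict_mono \<sigma>}"

definition Pi_space :: "(nat \<Rightarrow> nat) topology" where
  "Pi_space = subtopology baire_space {\<pi>. bij \<pi>}"

definition Sigma_preserving :: "'a topology \<Rightarrow> nat set set \<Rightarrow> (nat \<Rightarrow> 'a) \<Rightarrow> (nat \<Rightarrow> nat) set" where
  "Sigma_preserving X I x =
     {\<sigma>. strict_mono \<sigma> \<and> cluster_points X I (x \<circ> \<sigma>) = cluster_points X I x}"

definition Pi_preserving :: "'a topology \<Rightarrow> nat set set \<Rightarrow> (nat \<Rightarrow> 'a) \<Rightarrow> (nat \<Rightarrow> nat) set" where
  "Pi_preserving X I x =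
     {\<pi>. bij \<pi> \<and> cluster_points X I (x \<circ> \<pi>) = cluster_points X I x}"

end

theory Submission
  imports Defs "HOL-Combinatorics.Transposition"
begin

text \<open>
  By a Baire category argument it suffices to show that, for comeager many \<open>f\<close> in either space, the
  \<open>I\<close>-cluster points of \<open>x \<circ> f\<close> are exactly the accumulation points of \<open>x\<close>. Talagrand's
  characterisation provides consecutive intervals such that no set in \<open>I\<close> contains infinitely many
  of them. If \<open>A\<close> is infinite, every finite initial segment of an increasing function or of a
  permutation extends so as to map a further interval into \<open>A\<close>; hence generically the preimage of
  \<open>A\<close> is not in \<open>I\<close>. Apply this to the countably many sets \<open>{n. x n \<in> V}\<close>, with \<open>V\<close> running
  through countable local bases at the points of a countable dense subset of the closed set of
  accumulation points.
\<close>

section \<open>Sequence spaces and Baire category\<close>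

text \<open>A basic open set of the product constrains finitely many coordinates, all below some
  \<open>q\<close>, and singletons are open in the discrete factors. So the sets fixing an initial
  segment form a base, for Cantor and Baire space alike.\<close>

lemma openin_seq_space_iff:
  "openin (product_topology (\<lambda>_::nat. discrete_topology (UNIV :: 'b set)) UNIV) U \<longleftrightarrow>
    (\<forall>z\<in>U. \<exists>q. \<forall>w. (\<forall>i<q. w i = z i) \<longrightarrow> w \<in> U)"
proof (intro iffI ballI)
  fix z
  assume "openin (product_topology (\<lambda>_::nat. discrete_topology (UNIV :: 'b set)) UNIV) U" "z \<in> U"
  then obtain V where V: "finite {i. V i \<noteq> (UNIV :: 'b set)}" "z \<in> Pi\<^sub>E UNIV V" "Pi\<^sub>E UNIV V \<subseteq> U"
    unfolding openin_product_topology_alt by force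
  from V(1) obtain q where q: "\<And>i. V i \<noteq> UNIV \<Longrightarrow> i < q"
    unfolding finite_nat_set_iff_bounded by auto
  show "\<exists>q. \<forall>w. (\<forall>i<q. w i = z i) \<longrightarrow> w \<in> U"
  proof (intro exI allI impI)
    fix w assume w: "\<forall>i<q. w i = z i"
    have "w i \<in> V i" for i
    proof (cases "V i = UNIV")
      case False
      then show ?thesis using q[OF False] w V(2) by auto
    qed simp
    then show "w \<in> U" using V(3) by auto
  qed
next
  assume *: "\<forall>z\<in>U. \<exists>q. \<forall>w. (\<forall>i<q. w i = z i) \<longrightarrow> w \<in> U"
  show "openin (product_topology (\<lambda>_::nat. discrete_topology (UNIV :: 'b set)) UNIV) U"
    unfolding openin_product_topology_alt
  proof
    fix z assume "z \<in> U"
    with * obtain q where q: "\<And>w. (\<forall>i<q. w i = z i) \<Longrightarrow> w \<in> U" by blast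
    let ?V = "\<lambda>i. if i < q then {z i} else (UNIV :: 'b set)"
    have "finite {i. ?V i \<noteq> UNIV}"
      by (rule finite_subset[of _ "{..<q}"]) auto
    moreover have "Pi\<^sub>E UNIV ?V \<subseteq> U"
      by (auto intro!: q simp: PiE_iff split: if_splits)
    ultimately show "\<exists>V. finite {i \<in> UNIV. V i \<noteq> topspace (discrete_topology (UNIV :: 'b set))} \<and>
        (\<forall>i\<in>UNIV. openin (discrete_topology UNIV) (V i)) \<and> z \<in> Pi\<^sub>E UNIV V \<and> Pi\<^sub>E UNIV V \<subseteq> U"
      by (intro exI[of _ ?V]) auto
  qed
qed

lemma nowhere_dense_in_subset:
  assumes "nowhere_dense_in T N" "M \<subseteq> N"
  shows "nowhere_dense_in T M"
  using assms interior_of_mono[OF closure_of_mono[OF assms(2)], of T T]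
  unfolding nowhere_dense_in_def by auto

lemma meager_inE:
  assumes "meager_in T S"
  obtains \<N> where "countable \<N>" "\<forall>N\<in>\<N>. nowhere_dense_in T N" "S = \<Union>\<N>"
proof -
  from assms obtain \<N> where "countable \<N> \<and> (\<forall>N\<in>\<N>. nowhere_dense_in T N) \<and> S = \<Union>\<N>"
    unfolding meager_in_def by (rule exE)
  then show ?thesis by (intro that[of \<N>]) simp_all
qed

lemma meager_in_subset:
  assumes "meager_in T S" "R \<subseteq> S"
  shows "meager_in T R"
proof -
  obtain \<N> where \<N>: "countable \<N>" "\<forall>N\<in>\<N>. nowhere_dense_in T N" "S = \<Union>\<N>"
    using assms(1) by (rule meager_inE) (rule that)
  show ?thesis unfolding meager_in_def
    \<comment> \<open>\<open>meager_in\<close> asks for an exact union, so every member of the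
      family is cut down to \<open>R\<close>.\<close>
    using \<N> assms(2)
    by (intro exI[of _ "(\<inter>) R ` \<N>"]) (auto intro: nowhere_dense_in_subset[of T])
qed

lemma meager_in_UN:
  assumes "countable J" "\<And>j. j \<in> J \<Longrightarrow> meager_in T (S j)"
  shows "meager_in T (\<Union>j\<in>J. S j)"
proof -
  obtain \<N> where "\<forall>j\<in>J. countable (\<N> j) \<and> (\<forall>N\<in>\<N> j. nowhere_dense_in T N) \<and> S j = \<Union>(\<N> j)"
    using assms(2) unfolding meager_in_def by metis
  then show ?thesis unfolding meager_in_def
    using assms(1) by (intro exI[of _ "\<Union>(\<N> ` J)"]) auto
qed

text \<open>Baire's theorem: replacing nowhere dense sets by their closures gives closed sets with
  empty interior, whose countable union has empty interior and so cannot be the whole nonempty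
  space.\<close>

lemma not_meager_in_topspace:
  assumes "completely_metrizable_space T" "topspace T \<noteq> {}"
  shows "\<not> meager_in T (topspace T)"
proof
  assume "meager_in T (topspace T)"
  then obtain \<N> where \<N>: "countable \<N>" "\<forall>N\<in>\<N>. nowhere_dense_in T N" "topspace T = \<Union>\<N>"
    by (rule meager_inE) (rule that)
  have "T interior_of \<Union>((closure_of) T ` \<N>) = {}"
  proof (rule Baire_category_alt)
    show "countable ((closure_of) T ` \<N>)" using \<N>(1) by (rule countable_image)
    show "closedin T C \<and> T interior_of C = {}" if "C \<in> (closure_of) T ` \<N>" for C
      using that \<N>(2) by (auto simp: nowhere_dense_in_def)
  qed (simp add: assms(1))
  moreover have "\<Union>((closure_of) T ` \<N>) = topspace T"
  proof
    have "\<Union>\<N> \<subseteq> \<Union>((closure_of) T ` \<N>)"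
    proof (rule Union_least)
      fix N assume "N \<in> \<N>"
      then have "N \<subseteq> T closure_of N"
        using \<N>(2) by (intro closure_of_subset) (simp add: nowhere_dense_in_def)
      then show "N \<subseteq> \<Union>((closure_of) T ` \<N>)" using \<open>N \<in> \<N>\<close> by blast
    qed
    then show "topspace T \<subseteq> \<Union>((closure_of) T ` \<N>)" by (simp only: \<N>(3))
  qed (use closure_of_subset_topspace[of T] in blast)
  ultimately show False using assms(2) by simp
qed

section \<open>Talagrand's characterisation\<close>

text \<open>The closure of \<open>N\<close> has empty interior, so the cylinder given by the first
  \<open>p\<close> values of \<open>z\<close> contains a point \<open>w\<close> outside it. The
  complement of the closure is open, hence contains a whole cylinder around
  \<open>w\<close>.\<close>

lemma nowhere_dense_in_cantor_space_extend:
  assumes "nowhere_dense_in cantor_space N"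
  obtains w q where "p \<le> q" "\<And>i. i < p \<Longrightarrow> w i = z i"
    "\<And>v. (\<And>i. i < q \<Longrightarrow> v i = w i) \<Longrightarrow> v \<notin> N"
proof -
  let ?C = "cantor_space closure_of N" and ?U = "{v :: nat \<Rightarrow> bool. \<forall>i<p. v i = z i}"
  have op: "openin cantor_space U \<longleftrightarrow> (\<forall>z\<in>U. \<exists>q. \<forall>w. (\<forall>i<q. w i = z i) \<longrightarrow> w \<in> U)" for U
    unfolding cantor_space_def by (rule openin_seq_space_iff)
  have top: "topspace cantor_space = UNIV" by (simp add: cantor_space_def)
  have "openin cantor_space ?U" unfolding op by auto
  moreover have "z \<in> ?U" by simp
  ultimately have "\<not> ?U \<subseteq> ?C"
    using assms interior_of_maximal[of ?U ?C cantor_space] unfolding nowhere_dense_in_def by blast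
  then obtain w where w: "w \<in> ?U" "w \<in> - ?C" by blast
  have "openin cantor_space (- ?C)"
    using openin_diff[OF openin_topspace closedin_closure_of, of cantor_space N]
    by (simp add: top Compl_eq_Diff_UNIV)
  with w(2) obtain q where q: "\<And>v. (\<forall>i<q. v i = w i) \<Longrightarrow> v \<in> - ?C" unfolding op by blast
  have "N \<subseteq> ?C" by (simp add: closure_of_subset top)
  with q w(1) show ?thesis by (intro that[of "max p q" w]) auto
qed

text \<open>The block is prolonged once for each \<open>N\<close> and each of the finitely many prefixes of length \<open>p\<close>.\<close>

lemma nowhere_dense_in_cantor_space_block:
  assumes "finite \<N>" "\<forall>N\<in>\<N>. nowhere_dense_in cantor_space N"
  obtains q s where "p < q"
    "\<forall>v. (\<forall>i\<in>{p..<q}. v i = s i) \<longrightarrow> (\<forall>N\<in>\<N>. v \<notin> N)"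
proof -
  \<comment> \<open>Generalised to an arbitrary finite set of pairs (prefix, nowhere dense set) so
    that induction can treat one pair at a time. Only the values of \<open>s\<close> on
    \<open>{p..<q}\<close> matter.\<close>
  have ext: "\<exists>q>p. \<exists>s. \<forall>t N v. (t, N) \<in> P \<longrightarrow>
      (\<forall>i<p. v i = t i) \<longrightarrow> (\<forall>i\<in>{p..<q}. v i = s i) \<longrightarrow> v \<notin> N"
    if "finite P" "\<And>t N. (t, N) \<in> P \<Longrightarrow> nowhere_dense_in cantor_space N"
    for P :: "((nat \<Rightarrow> bool) \<times> (nat \<Rightarrow> bool) set) set"
    using that
  proof (induction P rule: finite_induct)
    case empty
    show ?case by (intro exI[of _ "Suc p"]) auto
  next
    case (insert c P)
    obtain t N where c: "c = (t, N)" by (cases c)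
    have "\<exists>q>p. \<exists>s. \<forall>t N v. (t, N) \<in> P \<longrightarrow>
        (\<forall>i<p. v i = t i) \<longrightarrow> (\<forall>i\<in>{p..<q}. v i = s i) \<longrightarrow> v \<notin> N"
      by (rule insert.IH) (use insert.prems in blast)
    then obtain q s where q: "p < q" and
      s: "\<forall>t N v. (t, N) \<in> P \<longrightarrow>
        (\<forall>i<p. v i = t i) \<longrightarrow> (\<forall>i\<in>{p..<q}. v i = s i) \<longrightarrow> v \<notin> N"
      by (elim exE conjE) (rule that)
    have "nowhere_dense_in cantor_space N" using insert.prems c by blast
    \<comment> \<open>The prolongation starts from the prefix \<open>t\<close> followed by the
      pattern found so far. As \<open>w\<close> keeps that pattern on \<open>{p..<q}\<close>, the
      earlier pairs remain avoided.\<close>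
    then obtain w r where r: "q \<le> r" and w: "\<And>i. i < q \<Longrightarrow> w i = (if i < p then t i else s i)"
      and avoid: "\<And>v. (\<And>i. i < r \<Longrightarrow> v i = w i) \<Longrightarrow> v \<notin> N"
      by (rule nowhere_dense_in_cantor_space_extend[where p = q
            and z = "\<lambda>i. if i < p then t i else s i"]) blast
    have "v \<notin> M" if "(u, M) \<in> insert c P" "\<forall>i<p. v i = u i" "\<forall>i\<in>{p..<r}. v i = w i" for u M v
    proof (cases "(u, M) \<in> P")
      case True
      have "\<forall>i\<in>{p..<q}. v i = s i" using that(3) r w by auto
      with True that(2) s show ?thesis by simp
    next
      case False
      then have uM: "u = t" "M = N" using that(1) c by auto
      have "v i = w i" if "i < r" for i
      proof (cases "i < p")
        case True
        then show ?thesis using \<open>\<forall>i<p. v i = u i\<close> uM w[of i] q by auto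
      next
        case False
        then show ?thesis using \<open>\<forall>i\<in>{p..<r}. v i = w i\<close> that by auto
      qed
      then show ?thesis using avoid uM by blast
    qed
    moreover have "p < r" using q r by simp
    ultimately show ?case by (intro exI[of _ r] conjI exI[of _ w]) blast+
  qed
  \<comment> \<open>Prefixes are coded as extensional functions on \<open>{..<p}\<close>, which
    makes them finite in number; \<open>restrict\<close> later turns an arbitrary \<open>v\<close>
    into its prefix.\<close>
  have "finite ((\<Pi>\<^sub>E i\<in>{..<p}. (UNIV :: bool set)) \<times> \<N>)"
    using assms(1) by (intro finite_cartesian_product finite_PiE) auto
  moreover have "nowhere_dense_in cantor_space N"
    if "(t, N) \<in> (\<Pi>\<^sub>E i\<in>{..<p}. (UNIV :: bool set)) \<times> \<N>" for t N
    using that assms(2) by blast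
  ultimately have "\<exists>q>p. \<exists>s. \<forall>t N v. (t, N) \<in> (\<Pi>\<^sub>E i\<in>{..<p}. UNIV) \<times> \<N> \<longrightarrow>
      (\<forall>i<p. v i = t i) \<longrightarrow> (\<forall>i\<in>{p..<q}. v i = s i) \<longrightarrow> v \<notin> N"
    by (rule ext)
  then obtain q s where q: "p < q" and
    s: "\<forall>t N v. (t, N) \<in> (\<Pi>\<^sub>E i\<in>{..<p}. UNIV) \<times> \<N> \<longrightarrow>
      (\<forall>i<p. v i = t i) \<longrightarrow> (\<forall>i\<in>{p..<q}. v i = s i) \<longrightarrow> v \<notin> N"
    by (elim exE conjE) (rule that)
  show ?thesis
  proof (rule that[OF q], intro allI impI ballI)
    fix v N assume v: "\<forall>i\<in>{p..<q}. v i = s i" and N: "N \<in> \<N>"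
    have "(restrict v {..<p}, N) \<in> (\<Pi>\<^sub>E i\<in>{..<p}. (UNIV :: bool set)) \<times> \<N>"
      using N by auto
    then show "v \<notin> N" by (rule s[rule_format]) (simp_all add: v)
  qed
qed

lemma strict_mono_blocks_disjoint:
  fixes n :: "nat \<Rightarrow> nat"
  assumes "strict_mono n" "i \<in> {n j..<n (Suc j)}" "i \<in> {n k..<n (Suc k)}"
  shows "j = k"
proof -
  have "\<not> a < b" if "i < n (Suc a)" "n b \<le> i" for a b
    using that strict_mono_less_eq[OF assms(1), of "Suc a" b] by auto
  then show ?thesis using assms by (metis atLeastLessThan_iff linorder_neqE_nat)
qed

text \<open>Let \<open>I\<close> be covered by nowhere dense sets \<open>F j\<close>. Block
  \<open>k\<close> carries a pattern such that every point following it there avoids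
  \<open>F j\<close> for all \<open>j \<le> k\<close>. A set containing infinitely many blocks can
  be thinned to follow their patterns; the thinned set avoids every \<open>F j\<close>, so it is not
  in \<open>I\<close>, and neither is the original set.\<close>

lemma meager_ideal_blocks:
  assumes "meager_ideal I"
  obtains n :: "nat \<Rightarrow> nat" where "strict_mono n"
    "\<And>Z. infinite {k. {n k..<n (Suc k)} \<subseteq> Z} \<Longrightarrow> Z \<notin> I"
proof -
  have "meager_in cantor_space ((\<lambda>A n. n \<in> A) ` I)"
    using assms unfolding meager_ideal_def by blast
  then obtain \<N> where \<N>: "countable \<N>" "\<forall>N\<in>\<N>. nowhere_dense_in cantor_space N"
    and I: "(\<lambda>A n. n \<in> A) ` I = \<Union>\<N>"
    by (rule meager_inE) (rule that)
  have sub: "B \<in> I" if "A \<in> I" "B \<subseteq> A" for A B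
    using assms that unfolding meager_ideal_def nat_ideal_def by blast
  have "{} \<in> I" using assms unfolding meager_ideal_def nat_ideal_def by auto
  \<comment> \<open>An enumeration by \<open>from_nat_into\<close> has the right range only for a
    nonempty family.\<close>
  then have "\<N> \<noteq> {}" using I by auto
  define F where "F = from_nat_into \<N>"
  have F: "range F = \<N>" unfolding F_def by (simp add: \<N>(1) \<open>\<N> \<noteq> {}\<close>)
  have "\<exists>q s. p < q \<and> (\<forall>j\<le>k. \<forall>v. (\<forall>i\<in>{p..<q}. v i = s i) \<longrightarrow> v \<notin> F j)" for k p :: nat
  proof -
    have "finite (F ` {..k})" "\<forall>N\<in>F ` {..k}. nowhere_dense_in cantor_space N"
      using \<N>(2) F by auto
    then obtain q s where "p < q" "\<forall>v. (\<forall>i\<in>{p..<q}. v i = s i) \<longrightarrow> (\<forall>N\<in>F ` {..k}. v \<notin> N)"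
      by (rule nowhere_dense_in_cantor_space_block[where p = p]) (rule that)
    then show ?thesis by (intro exI[of _ q] exI[of _ s]) simp
  qed
  then have "\<forall>k p. \<exists>q s. p < q \<and> (\<forall>j\<le>k. \<forall>v. (\<forall>i\<in>{p..<q}. v i = s i) \<longrightarrow> v \<notin> F j)"
    by (intro allI)
  then obtain q s where "\<forall>k p. p < q k p \<and>
      (\<forall>j\<le>k. \<forall>v. (\<forall>i\<in>{p..<q k p}. v i = s k p i) \<longrightarrow> v \<notin> F j)"
    unfolding choice_iff by (elim exE) (rule that)
  then have q: "p < q k p" and
    s: "\<lbrakk>j \<le> k; \<forall>i\<in>{p..<q k p}. v i = s k p i\<rbrakk> \<Longrightarrow> v \<notin> F j" for k p j v
    by simp_all
  define n where "n = rec_nat 0 q"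
  have n_Suc: "n (Suc k) = q k (n k)" for k by (simp add: n_def)
  have mono: "strict_mono n" using q by (simp add: strict_mono_Suc_iff n_Suc)
  show ?thesis
  proof (rule that[OF mono], rule notI)
    fix Z assume inf: "infinite {k. {n k..<n (Suc k)} \<subseteq> Z}" and "Z \<in> I"
    \<comment> \<open>\<open>W\<close> follows the pattern on each block contained in
      \<open>Z\<close> and is empty elsewhere. Disjointness of the blocks ensures that no other
      block interferes with its values on block \<open>k\<close>.\<close>
    define W where "W = {i. \<exists>k. {n k..<n (Suc k)} \<subseteq> Z \<and> i \<in> {n k..<n (Suc k)} \<and> s k (n k) i}"
    have "W \<in> I" using \<open>Z \<in> I\<close> by (rule sub) (auto simp: W_def)
    then obtain j where j: "(\<lambda>i. i \<in> W) \<in> F j" using I F by blast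
    obtain k where k: "j \<le> k" "{n k..<n (Suc k)} \<subseteq> Z"
      using inf unfolding infinite_nat_iff_unbounded_le by blast
    have "(i \<in> W) = s k (n k) i" if "i \<in> {n k..<n (Suc k)}" for i
      using that k(2) strict_mono_blocks_disjoint[OF mono that] unfolding W_def by blast
    then have "(\<lambda>i. i \<in> W) \<notin> F j" using k(1) by (intro s[where p = "n k"]) (auto simp: n_Suc)
    with j show False by blast
  qed
qed

section \<open>Generic preimages of infinite sets\<close>

text \<open>Isolates what increasing functions and permutations share in the density argument, so
  that one proof serves both spaces.\<close>

definition extends_into_infinite :: "(nat \<Rightarrow> nat) set \<Rightarrow> bool" where
  "extends_into_infinite S \<longleftrightarrow>
    (\<forall>f\<in>S. \<forall>A p q. infinite A \<longrightarrow> (\<exists>g\<in>S. (\<forall>i<p. g i = f i) \<and> (\<forall>i\<in>{p..<q}. g i \<in> A)))"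

lemma openin_baire_space_iff:
  "openin baire_space U \<longleftrightarrow> (\<forall>z\<in>U. \<exists>q. \<forall>w. (\<forall>i<q. w i = z i) \<longrightarrow> w \<in> U)"
  unfolding baire_space_def by (rule openin_seq_space_iff)

lemma topspace_baire_space [simp]: "topspace baire_space = UNIV"
  by (simp add: baire_space_def)

text \<open>\<open>D m\<close> asks that some block of index at least \<open>m\<close> be mapped
  into \<open>A\<close>. It is open because a block is finite, and dense in \<open>S\<close> by the
  extension property. A function lying in every \<open>D m\<close> maps infinitely many blocks into
  \<open>A\<close>, so its preimage of \<open>A\<close> is not in \<open>I\<close>.\<close>

lemma meager_in_preimage_in_ideal:
  assumes "meager_ideal I" "extends_into_infinite S" "infinite A"
  shows "meager_in (subtopology baire_space S) {f \<in> S. f -` A \<in> I}"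
proof -
  let ?T = "subtopology baire_space S"
  obtain n where n: "strict_mono n" "\<And>Z. infinite {k. {n k..<n (Suc k)} \<subseteq> Z} \<Longrightarrow> Z \<notin> I"
    using meager_ideal_blocks[OF assms(1)] by blast
  define D where "D m = {f. \<exists>k\<ge>m. {n k..<n (Suc k)} \<subseteq> f -` A}" for m
  have "openin baire_space (D m)" for m
    unfolding openin_baire_space_iff
  proof
    fix f assume "f \<in> D m"
    then obtain k where k: "k \<ge> m" "{n k..<n (Suc k)} \<subseteq> f -` A" unfolding D_def by blast
    then show "\<exists>q. \<forall>w. (\<forall>i<q. w i = f i) \<longrightarrow> w \<in> D m"
      unfolding D_def by (intro exI[of _ "n (Suc k)"] allI impI CollectI exI[of _ k]) auto
  qed
  then have "openin ?T (S \<inter> D m)" for m by (rule openin_subtopology_Int2)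
  then have closed: "closedin ?T (S - D m)" for m
    by (auto simp: closedin_def Diff_Diff_Int)
  have "nowhere_dense_in ?T (S - D m)" for m
  proof -
    have empty: "U = {}" if U: "openin ?T U" "U \<subseteq> S - D m" for U
    proof (rule ccontr)
      assume "U \<noteq> {}"
      then obtain f where f: "f \<in> U" by blast
      obtain V where V: "openin baire_space V" "U = V \<inter> S"
        using U(1) unfolding openin_subtopology by blast
      then obtain p where p: "\<And>w. (\<forall>i<p. w i = f i) \<Longrightarrow> w \<in> V"
        using f unfolding openin_baire_space_iff by blast
      \<comment> \<open>The index is at least \<open>m\<close>, as \<open>D m\<close> demands, and
        \<open>n k \<ge> k \<ge> p\<close>, so changing \<open>f\<close> from \<open>n k\<close> on
        does not leave \<open>V\<close>.\<close>
      define k where "k = max m p"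
      have "p \<le> n k" using strict_mono_imp_increasing[OF n(1), of k] by (simp add: k_def)
      obtain g where g: "g \<in> S" "\<forall>i<n k. g i = f i" "\<forall>i\<in>{n k..<n (Suc k)}. g i \<in> A"
        using assms(2,3) f V(2) unfolding extends_into_infinite_def by blast
      have "g \<in> U" using g V(2) p \<open>p \<le> n k\<close> by auto
      moreover have "g \<in> D m" using g(3) unfolding D_def by (auto intro: exI[of _ k] simp: k_def)
      ultimately show False using U(2) by blast
    qed
    have "?T interior_of (S - D m) = {}"
      by (intro empty openin_interior_of interior_of_subset)
    then show ?thesis
      using closed[of m] by (auto simp: nowhere_dense_in_def closure_of_closedin)
  qed
  then have "meager_in ?T (\<Union>m. S - D m)"
    unfolding meager_in_def by (intro exI[of _ "range (\<lambda>m. S - D m)"]) auto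
  moreover have "{f \<in> S. f -` A \<in> I} \<subseteq> (\<Union>m. S - D m)"
  proof
    fix f assume f: "f \<in> {f \<in> S. f -` A \<in> I}"
    then have "finite {k. {n k..<n (Suc k)} \<subseteq> f -` A}" using n(2) by blast
    then obtain m where "\<And>k. {n k..<n (Suc k)} \<subseteq> f -` A \<Longrightarrow> k < m"
      unfolding finite_nat_set_iff_bounded by blast
    then have "f \<notin> D m" unfolding D_def by (auto simp: not_le[symmetric])
    then show "f \<in> (\<Union>m. S - D m)" using f by blast
  qed
  ultimately show ?thesis by (rule meager_in_subset)
qed

lemma extends_into_infinite_strict_mono: "extends_into_infinite {f. strict_mono f}"
  unfolding extends_into_infinite_def
proof (intro ballI allI impI)
  fix f :: "nat \<Rightarrow> nat" and A :: "nat set" and p q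
  assume f: "f \<in> {f. strict_mono f}" and "infinite A"
  \<comment> \<open>Discarding the values up to \<open>f p\<close> puts the new tail above all of
    \<open>f 0, ..., f (p - 1)\<close>, so the two pieces join monotonically.\<close>
  define B where "B = A - {..f p}"
  have B: "infinite B" unfolding B_def using \<open>infinite A\<close> by simp
  define g where "g i = (if i < p then f i else enumerate B (i - p))" for i
  have gB: "g i \<in> B" if "p \<le> i" for i
    using that enumerate_in_set[OF B] by (simp add: g_def)
  have "g i < g (Suc i)" for i
  proof (cases "p \<le> i")
    case True
    then show ?thesis using enumerate_step[OF B] by (simp add: g_def Suc_diff_le)
  next
    case False
    have "f i < f (Suc i)" "f i < f p" using f False by (auto simp: strict_mono_less)
    then show ?thesis using False gB[of "Suc i"] by (auto simp: g_def B_def not_le)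
  qed
  then have "strict_mono g" by (simp add: strict_mono_Suc_iff)
  then show "\<exists>g\<in>{f. strict_mono f}. (\<forall>i<p. g i = f i) \<and> (\<forall>i\<in>{p..<q}. g i \<in> A)"
    using gB by (intro bexI[of _ g]) (auto simp: g_def B_def)
qed

lemma extends_into_infinite_bij: "extends_into_infinite {f. bij f}"
  unfolding extends_into_infinite_def
proof (intro ballI allI impI)
  fix f :: "nat \<Rightarrow> nat" and A :: "nat set" and p q :: nat
  assume f: "f \<in> {f. bij f}" and A: "infinite A"
  show "\<exists>g\<in>{f. bij f}. (\<forall>i<p. g i = f i) \<and> (\<forall>i\<in>{p..<q}. g i \<in> A)"
  proof (induction q)
    case 0
    show ?case using f by auto
  next
    case (Suc q)
    then obtain g where g: "bij g" "\<And>i. i < p \<Longrightarrow> g i = f i" "\<And>i. i \<in> {p..<q} \<Longrightarrow> g i \<in> A"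
      by blast
    show ?case
    proof (cases "p \<le> q")
      case False
      then show ?thesis using g by auto
    next
      case True
      have "infinite (A - g ` {..q})" using A by simp
      then obtain b where b: "b \<in> A" "b \<notin> g ` {..q}"
        by (metis DiffD1 DiffD2 ex_in_conv finite.emptyI)
      \<comment> \<open>Exchanging the values \<open>g q\<close> and \<open>b\<close> keeps a
        bijection. Values at \<open>i < q\<close> survive: they differ from \<open>g q\<close> by
        injectivity and from \<open>b\<close> by its choice.\<close>
      define h where "h = Transposition.transpose (g q) b \<circ> g"
      have "bij h" unfolding h_def using g(1) by (intro bij_comp) auto
      moreover have "h i = g i" if "i < q" for i
        using that b bij_is_inj[OF g(1)] unfolding h_def
        by (auto simp: Transposition.transpose_def inj_eq)
      moreover have "h q = b" by (simp add: h_def)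
      ultimately show ?thesis using g b True
        by (intro bexI[of _ h]) (auto simp: less_Suc_eq)
    qed
  qed
qed

section \<open>The spaces of subsequences and of permutations\<close>

text \<open>Baire space is a countable product of discrete spaces, and complete metrizability passes
  to countable intersections of open sets.\<close>

lemma completely_metrizable_baire_space_INT:
  assumes "\<And>n :: nat. openin baire_space (U n)"
  shows "completely_metrizable_space (subtopology baire_space (\<Inter>n. U n))"
proof (rule completely_metrizable_space_gdelta_in_alt)
  show "completely_metrizable_space baire_space"
    unfolding baire_space_def
    by (simp add: completely_metrizable_space_product_topology
        completely_metrizable_space_discrete_topology)
  show "(countable intersection_of openin baire_space) (\<Inter>n. U n)"
    unfolding intersection_of_def
    using assms by (intro exI[of _ "range U"]) auto
qed

lemma completely_metrizable_Sigma_space: "completely_metrizable_space Sigma_space"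
proof -
  have "openin baire_space {f. f n < f (Suc n)}" for n
    unfolding openin_baire_space_iff by (auto intro!: exI[of _ "Suc (Suc n)"])
  then have "completely_metrizable_space (subtopology baire_space (\<Inter>n. {f. f n < f (Suc n)}))"
    by (rule completely_metrizable_baire_space_INT)
  moreover have "(\<Inter>n. {f. f n < f (Suc n)}) = {f :: nat \<Rightarrow> nat. strict_mono f}"
    by (auto simp: strict_mono_Suc_iff)
  ultimately show ?thesis by (simp add: Sigma_space_def)
qed

text \<open>Bijectivity is a countable conjunction of open conditions: injectivity on
  \<open>{..n}\<close> reads finitely many coordinates, and a single preimage witnesses that
  \<open>n\<close> is in the range.\<close>

lemma completely_metrizable_Pi_space: "completely_metrizable_space Pi_space"
proof -
  define U where "U n = {f :: nat \<Rightarrow> nat. inj_on f {..n} \<and> n \<in> range f}" for n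
  have "openin baire_space (U n)" for n
    unfolding openin_baire_space_iff
  proof
    fix f assume "f \<in> U n"
    then obtain m where m: "inj_on f {..n}" "f m = n" unfolding U_def by auto
    have "w \<in> U n" if "\<forall>i<Suc (max m n). w i = f i" for w
    proof -
      have "inj_on w {..n}" using m(1) that by (simp add: inj_on_def)
      moreover have "w m = n" using that m(2) by simp
      ultimately show ?thesis by (auto simp: U_def)
    qed
    then show "\<exists>q. \<forall>w. (\<forall>i<q. w i = f i) \<longrightarrow> w \<in> U n" by blast
  qed
  then have "completely_metrizable_space (subtopology baire_space (\<Inter>n. U n))"
    by (rule completely_metrizable_baire_space_INT)
  moreover have "(\<Inter>n. U n) = {f. bij f}"
  proof (intro set_eqI iffI)
    fix f assume f: "f \<in> (\<Inter>n. U n)"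
    have "inj f"
    proof (rule injI)
      fix i j assume "f i = f j"
      moreover have "inj_on f {..max i j}" using f by (auto simp: U_def)
      ultimately show "i = j" by (auto dest: inj_onD)
    qed
    moreover have "surj f" using f by (auto simp: U_def)
    ultimately show "f \<in> {f. bij f}" by (simp add: bij_def)
  qed (auto simp: U_def bij_def intro: inj_on_subset)
  ultimately show ?thesis by (simp add: Pi_space_def)
qed

section \<open>Cluster points\<close>

lemma cluster_points_antimono: "J \<subseteq> I \<Longrightarrow> cluster_points X I y \<subseteq> cluster_points X J y"
  unfolding cluster_points_def by blast

lemma accumulation_points_comp_inj_subset:
  assumes "inj f"
  shows "accumulation_points X (x \<circ> f) \<subseteq> accumulation_points X x"
proof -
  have "infinite {n. x n \<in> U}" if "infinite {n. x (f n) \<in> U}" for U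
  proof -
    have "infinite (f ` {n. x (f n) \<in> U})"
      using that assms by (simp add: finite_image_iff inj_on_subset)
    then show ?thesis by (rule infinite_super[rotated]) auto
  qed
  then show ?thesis unfolding accumulation_points_def cluster_points_def by auto
qed

text \<open>A neighborhood showing that \<open>l\<close> is not a cluster point is also a
  neighborhood of every point of an open set around \<open>l\<close>, and excludes them all.\<close>

lemma closedin_cluster_points: "closedin X (cluster_points X I y)"
proof -
  have "\<exists>V. openin X V \<and> l \<in> V \<and> V \<subseteq> topspace X - cluster_points X I y"
    if l: "l \<in> topspace X - cluster_points X I y" for l
  proof -
    obtain U V where U: "neighborhood_in X l U" "{n. y n \<in> U} \<in> I"
      and V: "openin X V" "l \<in> V" "V \<subseteq> U"
      using l unfolding cluster_points_def neighborhood_in_def by blast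
    have "neighborhood_in X m U" if "m \<in> V" for m
      using U(1) V that unfolding neighborhood_in_def by blast
    then have "V \<subseteq> topspace X - cluster_points X I y"
      using U(2) openin_subset[OF V(1)] unfolding cluster_points_def by blast
    with V show ?thesis by blast
  qed
  then have "openin X (topspace X - cluster_points X I y)"
    by (subst openin_subopen) blast
  then show ?thesis by (auto simp: closedin_def cluster_points_def)
qed

text \<open>Off a meager set, all points of the countable dense set \<open>C\<close> are
  \<open>I\<close>-cluster points of \<open>x \<circ> f\<close>, and closedness of the cluster set
  yields the remaining accumulation points. The reverse inclusion holds for every \<open>f\<close>
  in \<open>S\<close>, by injectivity.\<close>

lemma meager_in_cluster_points_ne_accumulation_points:
  assumes "first_countable X"
    and sep: "separable_space (subtopology X (accumulation_points X x))"
    and I: "meager_ideal I" and S: "extends_into_infinite S" "\<forall>f\<in>S. inj f"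
  shows "meager_in (subtopology baire_space S)
    {f \<in> S. cluster_points X I (x \<circ> f) \<noteq> accumulation_points X x}"
proof -
  let ?L = "accumulation_points X x" and ?T = "subtopology baire_space S"
  have L_sub: "?L \<subseteq> topspace X"
    unfolding accumulation_points_def cluster_points_def by blast
  obtain C where C: "countable C" "C \<subseteq> ?L" "subtopology X ?L closure_of C = ?L"
    using sep L_sub unfolding separable_space_def by (auto simp: Int_absorb1)
  have dense: "?L \<subseteq> X closure_of C"
    using C(3) by (metis closure_of_subtopology_subset)
  have "\<forall>l\<in>C. \<exists>\<B>. countable \<B> \<and> (\<forall>V\<in>\<B>. openin X V) \<and>
      (\<forall>U. openin X U \<and> l \<in> U \<longrightarrow> (\<exists>V\<in>\<B>. l \<in> V \<and> V \<subseteq> U))"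
  proof
    fix l assume "l \<in> C"
    then have "l \<in> topspace X" using C(2) L_sub by blast
    then show "\<exists>\<B>. countable \<B> \<and> (\<forall>V\<in>\<B>. openin X V) \<and>
        (\<forall>U. openin X U \<and> l \<in> U \<longrightarrow> (\<exists>V\<in>\<B>. l \<in> V \<and> V \<subseteq> U))"
      using assms(1) unfolding first_countable_def by (rule bspec[rotated])
  qed
  then obtain \<B> where \<B>: "\<And>l. l \<in> C \<Longrightarrow> countable (\<B> l)"
      "\<And>l V. \<lbrakk>l \<in> C; V \<in> \<B> l\<rbrakk> \<Longrightarrow> openin X V"
      "\<And>l U. \<lbrakk>l \<in> C; openin X U; l \<in> U\<rbrakk> \<Longrightarrow> \<exists>V\<in>\<B> l. l \<in> V \<and> V \<subseteq> U"
    by metis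
  have sub: "B \<in> I" if "A \<in> I" "B \<subseteq> A" for A B
    using I that unfolding meager_ideal_def nat_ideal_def by blast
  have fin: "{A. finite A} \<subseteq> I" using I unfolding meager_ideal_def nat_ideal_def by blast
  \<comment> \<open>Members of \<open>\<B> l\<close> may miss \<open>l\<close>; those that contain
    it are neighborhoods, so \<open>x\<close> visits them infinitely often.\<close>
  define P where "P = (SIGMA l:C. {V \<in> \<B> l. l \<in> V})"
  define E :: "'a \<times> 'a set \<Rightarrow> (nat \<Rightarrow> nat) set"
    where "E = (\<lambda>(l, V). {f \<in> S. f -` {n. x n \<in> V} \<in> I})"
  have "countable P" unfolding P_def using C(1) \<B>(1) by (intro countable_SIGMA) auto
  moreover have "meager_in ?T (E c)" if c: "c \<in> P" for c
  proof -
    obtain l V where lV: "c = (l, V)" "l \<in> C" "V \<in> \<B> l" "l \<in> V"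
      using c unfolding P_def by blast
    have "neighborhood_in X l V"
      using lV \<B>(2) openin_subset unfolding neighborhood_in_def by blast
    then have "infinite {n. x n \<in> V}"
      using lV(2) C(2) unfolding accumulation_points_def cluster_points_def by blast
    then show ?thesis
      unfolding E_def lV(1) by (simp add: meager_in_preimage_in_ideal[OF I S(1)] del: vimage_Collect_eq)
  qed
  ultimately have "meager_in ?T (\<Union>c\<in>P. E c)" by (rule meager_in_UN)
  moreover have "{f \<in> S. cluster_points X I (x \<circ> f) \<noteq> ?L} \<subseteq> (\<Union>c\<in>P. E c)"
  proof (rule ccontr)
    assume "\<not> ?thesis"
    then obtain f where f: "f \<in> S" "cluster_points X I (x \<circ> f) \<noteq> ?L"
      and notE: "\<And>c. c \<in> P \<Longrightarrow> f \<notin> E c"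
      by blast
    have "C \<subseteq> cluster_points X I (x \<circ> f)"
    proof
      fix l assume l: "l \<in> C"
      have "{n. (x \<circ> f) n \<in> U} \<notin> I" if U: "neighborhood_in X l U" for U
      proof
        assume UI: "{n. (x \<circ> f) n \<in> U} \<in> I"
        obtain V where V: "V \<in> \<B> l" "l \<in> V" "V \<subseteq> U"
          using U \<B>(3)[OF l] unfolding neighborhood_in_def by (meson order_trans)
        have "f -` {n. x n \<in> V} \<in> I" using UI by (rule sub) (use V(3) in auto)
        then have "f \<in> E (l, V)" using f(1) by (simp add: E_def)
        then show False using notE l V unfolding P_def by blast
      qed
      then show "l \<in> cluster_points X I (x \<circ> f)"
        using l C(2) L_sub unfolding cluster_points_def by blast
    qed
    then have "X closure_of C \<subseteq> cluster_points X I (x \<circ> f)"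
      by (rule closure_of_minimal) (rule closedin_cluster_points)
    moreover have "cluster_points X I (x \<circ> f) \<subseteq> ?L"
    proof (rule order_trans)
      show "cluster_points X I (x \<circ> f) \<subseteq> accumulation_points X (x \<circ> f)"
        unfolding accumulation_points_def by (rule cluster_points_antimono[OF fin])
      show "accumulation_points X (x \<circ> f) \<subseteq> ?L"
        using S(2) f(1) by (intro accumulation_points_comp_inj_subset) blast
    qed
    ultimately show False using dense f(2) by blast
  qed
  ultimately show ?thesis by (rule meager_in_subset)
qed

text \<open>If the two sets of points are equal, \<open>S - R\<close> lies in the meager set
  \<open>?M\<close>; otherwise \<open>R\<close> does. By Baire's theorem \<open>R\<close> and
  \<open>S - R\<close> are not both meager, which turns these implications into
  equivalences.\<close>

lemma cluster_preserving_category: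
  fixes x :: "nat \<Rightarrow> 'a"
  assumes X: "first_countable X" "separable_space (subtopology X (accumulation_points X x))"
    and I: "meager_ideal I" and S: "extends_into_infinite S" "\<forall>f\<in>S. inj f"
    and compl: "completely_metrizable_space (subtopology baire_space S)" and "S \<noteq> {}"
  defines "R \<equiv> {f \<in> S. cluster_points X I (x \<circ> f) = cluster_points X I x}"
  shows "comeager_in (subtopology baire_space S) R \<longleftrightarrow>
      cluster_points X I x = accumulation_points X x" (is ?comeager)
    and "\<not> meager_in (subtopology baire_space S) R \<longleftrightarrow>
      cluster_points X I x = accumulation_points X x" (is ?nonmeager)
proof -
  let ?T = "subtopology baire_space S" and ?\<Gamma> = "cluster_points X I x"
  let ?M = "{f \<in> S. cluster_points X I (x \<circ> f) \<noteq> accumulation_points X x}"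
  have M: "meager_in ?T ?M"
    by (rule meager_in_cluster_points_ne_accumulation_points[OF X I S])
  have not_both: "\<not> (meager_in ?T R \<and> meager_in ?T (S - R))"
  proof
    assume "meager_in ?T R \<and> meager_in ?T (S - R)"
    then have "meager_in ?T (\<Union>Q\<in>{R, S - R}. Q)" by (intro meager_in_UN) auto
    moreover have "(\<Union>Q\<in>{R, S - R}. Q) = topspace ?T" unfolding R_def by auto
    ultimately show False using not_meager_in_topspace[OF compl] \<open>S \<noteq> {}\<close> by simp
  qed
  have comeager: "comeager_in ?T R \<longleftrightarrow> meager_in ?T (S - R)"
    unfolding comeager_in_def by (auto simp: R_def)
  have "meager_in ?T (S - R)" if "?\<Gamma> = accumulation_points X x"
    using M by (rule meager_in_subset) (auto simp: R_def that)
  moreover have "meager_in ?T R" if "?\<Gamma> \<noteq> accumulation_points X x"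
    using M by (rule meager_in_subset) (use that in \<open>auto simp: R_def\<close>)
  ultimately show ?comeager ?nonmeager using not_both comeager by blast+
qed

theorem theorem2p2:
  fixes X :: "'a topology" and x :: "nat \<Rightarrow> 'a" and I :: "nat set set"
  assumes "first_countable X"
    and "Hausdorff_space X"
    and "\<And>C. closedin X C \<Longrightarrow> separable_space (subtopology X C)"
    and "\<And>n. x n \<in> topspace X"
    and "meager_ideal I"
  shows
    "(comeager_in Sigma_space (Sigma_preserving X I x)
        \<longleftrightarrow> \<not> meager_in Sigma_space (Sigma_preserving X I x)) \<and>
     (\<not> meager_in Sigma_space (Sigma_preserving X I x)
        \<longleftrightarrow> comeager_in Pi_space (Pi_preserving X I x)) \<and>
     (comeager_in Pi_space (Pi_preserving X I x)
        \<longleftrightarrow> \<not> meager_in Pi_space (Pi_preserving X I x)) \<and>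
     (\<not> meager_in Pi_space (Pi_preserving X I x)
        \<longleftrightarrow> cluster_points X I x = accumulation_points X x)"
proof -
  have "{f :: nat \<Rightarrow> nat. strict_mono f} \<noteq> {}" "{f :: nat \<Rightarrow> nat. bij f} \<noteq> {}"
    using strict_mono_id bij_id by blast+
  have "closedin X (accumulation_points X x)"
    unfolding accumulation_points_def by (rule closedin_cluster_points)
  note category = cluster_preserving_category[OF assms(1) assms(3)[OF this] assms(5)]
  have "\<forall>f\<in>{f :: nat \<Rightarrow> nat. strict_mono f}. inj f"
    by (simp add: strict_mono_imp_inj_on)
  note Sigma = category[OF extends_into_infinite_strict_mono this
      completely_metrizable_Sigma_space[unfolded Sigma_space_def]
      \<open>{f :: nat \<Rightarrow> nat. strict_mono f} \<noteq> {}\<close>]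
  have "\<forall>f\<in>{f :: nat \<Rightarrow> nat. bij f}. inj f"
    by (simp add: bij_is_inj)
  note Pi = category[OF extends_into_infinite_bij this
      completely_metrizable_Pi_space[unfolded Pi_space_def]
      \<open>{f :: nat \<Rightarrow> nat. bij f} \<noteq> {}\<close>]
  \<comment> \<open>Each of the four category statements is equivalent to the equality of the two
    sets of points, so the chain follows.\<close>
  show ?thesis
    using Sigma Pi
    unfolding Sigma_space_def Pi_space_def Sigma_preserving_def Pi_preserving_def
    by simp
qed

end
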